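(* Let $0<\alpha\le \frac{\mu}{4L^2}$ and let $\{z_k\}_{k\ge 0}$ be the iterates generated by stochastic Gradient Descent Ascent with constant stepsize $\alpha$, i.e. $z_{k+1}=z_k-\alpha\tilde\Phi(z_k)$ for all $k\ge 0$. Then for every $k\ge 1$, $$\mathbb{E}\big[\|z_k-z^*\|^2\big]\le (1-\alpha\mu)\,\mathbb{E}\big[\|z_{k-1}-z^*\|^2\big]+2\alpha^2\sigma^2 .$$ As a result, the error after $k$ steps satisfies $$\mathbb{E}\big[\|z_k-z^*\|^2\big]\le (1-\alpha\mu)^k\,\mathbb{E}\big[\|z_0-z^*\|^2\big]+\frac{2\alpha\sigma^2}{\mu}.$$
   Context: Objective. $f:\mathbb{R}^m\times\mathbb{R}^n\to\mathbb{R}$ is continuously differentiable. A convex function $\phi$ is called $\ell$-smooth if $\|\nabla\phi(u)-\nabla\phi(v)\|\le \ell\|u-v\|$ for all $u,v$, and $\nu$-strongly convex if $\phi(u)-\phi(v)-\nabla\phi(v)^\top(u-v)\ge\frac{\nu}{2}\|u-v\|^2$ for all $u,v$; $\phi$ is $\nu$-strongly concave if $-\phi$ is $\nu$-strongly convex. For every $\hat y$, $f(\cdot,\hat y)$ is $L_x$-smooth and $\mu_x$-strongly convex; for every $\hat x$, $f(\hat x,\cdot)$ is $L_y$-smooth and $\mu_y$-strongly concave ($\mu_x,\mu_y>0$). Moreover $\|\nabla_xf(x,y)-\nabla_xf(x,\hat y)\|\le L_{xy}\|y-\hat y\|$ for all $x,y,\hat y$ and $\|\nabla_yf(x,y)-\nabla_yf(\hat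 x,y)\|\le L_{yx}\|x-\hat x\|$ for all $x,\hat x,y$. Set $\mu=\min\{\mu_x,\mu_y\}$ and $L=\max\{L_x,L_y,L_{xy},L_{yx}\}$. Then $f$ has a unique saddle point $(x^*,y^* )$, i.e. $f(x^*,y)\le f(x^*,y^* )\le f(x,y^* )$ for all $x,y$, and $\nabla_xf(x^*,y^* )=0$, $\nabla_yf(x^*,y^* )=0$. Write $z=(x^\top,y^\top)^\top\in\mathbb{R}^{m+n}$ and $z^*=(x^{*\top},y^{*\top})^\top$; norms are Euclidean. Stochastic oracle. At an iterate $(x,y)$ one has access to random estimates $\tilde\nabla_xf(x,y)$ (using a random sample $\zeta$) and $\tilde\nabla_yf(x,y)$ (using a random sample $\xi$), where $\zeta,\xi$ are independent of each other and of previous iterates, such that $\mathbb{E}[\tilde\nabla_xf(x,y)\mid(x,y)]=\nabla_xf(x,y)$, $\mathbb{E}[\tilde\nabla_yf(x,y)\mid(x,y)]=\nabla_yf(x,y)$, $\mathbb{E}[\|\tilde\nabla_xf(x,y)-\nabla_xf(x,y)\|^2\mid(x,y)]\le\sigma^2$ and $\mathbb{E}[\|\tilde\nabla_yf(x,y)-\nabla_yf(x,y)\|^2\mid(x,y)]\le\sigma^2$. Fresh samples are drawn at each iterate. Define $\tilde\Phi(z)=\begin{bmatrix}\tilde\nabla_xf(x,y)\\-\tilde\nabla_yf(x,y)\end{bmatrix}$. *)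

theory Defs
  imports "HOL-Probability.Probability"
begin

text \<open>Meaningful only where \<open>\<phi>\<close> is differentiable.\<close>

definition grad :: "('a::euclidean_space \<Rightarrow> real) \<Rightarrow> 'a \<Rightarrow> 'a" where
  "grad \<phi> u = (THE d. GDERIV \<phi> u :> d)"

definition continuously_differentiable :: "('a::euclidean_space \<Rightarrow> real) \<Rightarrow> bool" where
  "continuously_differentiable \<phi> \<longleftrightarrow>
     (\<forall>u. \<phi> differentiable (at u)) \<and> continuous_on UNIV (grad \<phi>)"

text \<open>Smoothness does not include convexity, since it is also required of concave functions.\<close>

definition smooth_fun :: "real \<Rightarrow> ('a::euclidean_space \<Rightarrow> real) \<Rightarrow> bool" where
  "smooth_fun l \<phi> \<longleftrightarrow>
     (\<forall>u. \<phi> differentiable (at u)) \<and>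
     (\<forall>u v. norm (grad \<phi> u - grad \<phi> v) \<le> l * norm (u - v))"

definition strongly_convex :: "real \<Rightarrow> ('a::euclidean_space \<Rightarrow> real) \<Rightarrow> bool" where
  "strongly_convex \<nu> \<phi> \<longleftrightarrow>
     convex_on UNIV \<phi> \<and>
     (\<forall>u. \<phi> differentiable (at u)) \<and>
     (\<forall>u v. \<phi> u - \<phi> v - grad \<phi> v \<bullet> (u - v) \<ge> \<nu> / 2 * (norm (u - v))\<^sup>2)"

definition strongly_concave :: "real \<Rightarrow> ('a::euclidean_space \<Rightarrow> real) \<Rightarrow> bool" where
  "strongly_concave \<nu> \<phi> \<longleftrightarrow> strongly_convex \<nu> (\<lambda>u. - \<phi> u)"

text \<open>The stacked vector \<open>z\<close> is a pair \<open>(x, y)\<close>; the norm of the product type is the Euclidean norm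
  of the stacked vector.\<close>

definition grad_x :: "('a::euclidean_space \<times> 'b::euclidean_space \<Rightarrow> real) \<Rightarrow> 'a \<times> 'b \<Rightarrow> 'a" where
  "grad_x f z = grad (\<lambda>x. f (x, snd z)) (fst z)"

definition grad_y :: "('a::euclidean_space \<times> 'b::euclidean_space \<Rightarrow> real) \<Rightarrow> 'a \<times> 'b \<Rightarrow> 'b" where
  "grad_y f z = grad (\<lambda>y. f (fst z, y)) (snd z)"

definition saddle_point :: "('a \<times> 'b \<Rightarrow> real) \<Rightarrow> 'a \<times> 'b \<Rightarrow> bool" where
  "saddle_point f z \<longleftrightarrow>
     (\<forall>x y. f (fst z, y) \<le> f z \<and> f z \<le> f (x, snd z))"

definition generated_by :: "'w measure \<Rightarrow> 'a measure \<Rightarrow> ('w \<Rightarrow> 'a) \<Rightarrow> 'w measure" where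
  "generated_by M N X = vimage_algebra (space M) X N"

text \<open>\<open>indep_var\<close> requires both variables to have the same type, hence this heterogeneous version.\<close>

definition independent ::
    "'w measure \<Rightarrow> 'a measure \<Rightarrow> ('w \<Rightarrow> 'a) \<Rightarrow> 'b measure \<Rightarrow> ('w \<Rightarrow> 'b) \<Rightarrow> bool" where
  "independent M N X K Y \<longleftrightarrow>
     prob_space.indep_set M (sets (generated_by M N X)) (sets (generated_by M K Y))"

definition vec_cond_exp ::
    "'w measure \<Rightarrow> 'w measure \<Rightarrow> ('w \<Rightarrow> real ^ 'd) \<Rightarrow> 'w \<Rightarrow> real ^ 'd" where
  "vec_cond_exp M F X = (\<lambda>\<omega>. \<chi> i. real_cond_exp M F (\<lambda>\<omega>. X \<omega> $ i) \<omega>)"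

definition stoch_Phi ::
    "('a \<times> 'b \<Rightarrow> 's \<Rightarrow> 'a::euclidean_space) \<Rightarrow> ('a \<times> 'b \<Rightarrow> 't \<Rightarrow> 'b::euclidean_space) \<Rightarrow>
     's \<Rightarrow> 't \<Rightarrow> 'a \<times> 'b \<Rightarrow> 'a \<times> 'b" where
  "stoch_Phi gx gy s t z = (gx z s, - gy z t)"

text \<open>\<open>gx z s\<close> and \<open>gy z t\<close> are the gradient estimates at \<open>z\<close> computed from the samples \<open>s\<close> and \<open>t\<close>;
  \<open>\<zeta> k\<close> and \<open>\<xi> k\<close> are the samples drawn at the iterate \<open>z k\<close>. The two independence clauses together
  say that \<open>\<zeta> k\<close>, \<open>\<xi> k\<close> and the past are mutually independent, where the past consists of the
  iterates up to and including \<open>z k\<close> and of all earlier samples (freshness). The samples need not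
  be identically distributed.

  The conditional expectations are taken with respect to the sigma-algebra generated by \<open>z k\<close>. The
  estimates need not be integrable, because the law of \<open>z 0\<close> is arbitrary; but the variance bounds
  make the positive and negative parts occurring in \<open>real_cond_exp\<close> almost surely finite, so
  \<open>real_cond_exp\<close> is the genuine conditional expectation.\<close>

definition stochastic_oracle ::
    "'w measure \<Rightarrow> ((real ^ 'm) \<times> (real ^ 'n) \<Rightarrow> real) \<Rightarrow> real \<Rightarrow>
     's measure \<Rightarrow> 't measure \<Rightarrow>
     ((real ^ 'm) \<times> (real ^ 'n) \<Rightarrow> 's \<Rightarrow> real ^ 'm) \<Rightarrow>
     ((real ^ 'm) \<times> (real ^ 'n) \<Rightarrow> 't \<Rightarrow> real ^ 'n) \<Rightarrow>
     (nat \<Rightarrow> 'w \<Rightarrow> 's) \<Rightarrow> (nat \<Rightarrow> 'w \<Rightarrow> 't) \<Rightarrow>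
     (nat \<Rightarrow> 'w \<Rightarrow> (real ^ 'm) \<times> (real ^ 'n)) \<Rightarrow> bool" where
  "stochastic_oracle M f \<sigma> S T gx gy \<zeta> \<xi> z \<longleftrightarrow>
     (\<lambda>(u, s). gx u s) \<in> borel_measurable (borel \<Otimes>\<^sub>M S) \<and>
     (\<lambda>(u, t). gy u t) \<in> borel_measurable (borel \<Otimes>\<^sub>M T) \<and>
     (\<forall>k.
       \<zeta> k \<in> measurable M S \<and>
       \<xi> k \<in> measurable M T \<and>
       independent M S (\<zeta> k) T (\<xi> k) \<and>
       independent M
         (S \<Otimes>\<^sub>M T) (\<lambda>\<omega>. (\<zeta> k \<omega>, \<xi> k \<omega>))
         ((\<Pi>\<^sub>M i\<in>{..k}. borel) \<Otimes>\<^sub>M (\<Pi>\<^sub>M i\<in>{..<k}. S \<Otimes>\<^sub>M T))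
         (\<lambda>\<omega>. (\<lambda>i\<in>{..k}. z i \<omega>, \<lambda>i\<in>{..<k}. (\<zeta> i \<omega>, \<xi> i \<omega>))) \<and>
       (AE \<omega> in M. vec_cond_exp M (generated_by M borel (z k)) (\<lambda>\<omega>. gx (z k \<omega>) (\<zeta> k \<omega>)) \<omega>
                     = grad_x f (z k \<omega>)) \<and>
       (AE \<omega> in M. vec_cond_exp M (generated_by M borel (z k)) (\<lambda>\<omega>. gy (z k \<omega>) (\<xi> k \<omega>)) \<omega>
                     = grad_y f (z k \<omega>)) \<and>
       (AE \<omega> in M. nn_cond_exp M (generated_by M borel (z k))
                       (\<lambda>\<omega>. ennreal ((norm (gx (z k \<omega>) (\<zeta> k \<omega>) - grad_x f (z k \<omega>)))\<^sup>2)) \<omega>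
                     \<le> ennreal (\<sigma>\<^sup>2)) \<and>
       (AE \<omega> in M. nn_cond_exp M (generated_by M borel (z k))
                       (\<lambda>\<omega>. ennreal ((norm (gy (z k \<omega>) (\<xi> k \<omega>) - grad_y f (z k \<omega>)))\<^sup>2)) \<omega>
                     \<le> ennreal (\<sigma>\<^sup>2)))"

text \<open>The value lies in \<open>[0, \<infinity>]\<close>, so no moment of \<open>z 0\<close> has to be assumed finite.\<close>

definition mean_sq_dist :: "'w measure \<Rightarrow> ('w \<Rightarrow> 'a::real_normed_vector) \<Rightarrow> 'a \<Rightarrow> ennreal" where
  "mean_sq_dist M X c = (\<integral>\<^sup>+\<omega>. ennreal ((norm (X \<omega> - c))\<^sup>2) \<partial>M)"

end

theory Submission
  imports Defs
begin

text \<open>With \<open>\<Phi> = (\<nabla>\<^sub>x f, - \<nabla>\<^sub>y f)\<close>, strong convexity-concavity gives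
  \<open>(z - z\<^sup>*) \<bullet> \<Phi> z \<ge> \<mu> |z - z\<^sup>*|\<^sup>2\<close> and the Lipschitz bounds give \<open>|\<Phi> z|\<^sup>2 \<le> 4 L\<^sup>2 |z - z\<^sup>*|\<^sup>2\<close>, so that for
  \<open>\<alpha> \<le> \<mu> / (4 L\<^sup>2)\<close> an exact step multiplies the squared distance by at most \<open>1 - \<alpha> \<mu>\<close>. The noise of a
  stochastic step is conditionally centred given the iterate, hence orthogonal in \<open>L\<^sup>2\<close> to the exact
  step, and only adds its variance \<open>2 \<alpha>\<^sup>2 \<sigma>\<^sup>2\<close>. Since no moment of \<open>z\<^sub>0\<close> is assumed, orthogonality is used
  only if the exact step is square integrable; otherwise the right-hand side is infinite.\<close>

subsection \<open>Gradients\<close>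

lemma grad_eqI:
  assumes "GDERIV \<phi> u :> d"
  shows "grad \<phi> u = d"
  unfolding grad_def
proof (rule the_equality)
  fix d' assume "GDERIV \<phi> u :> d'"
  then have "(\<lambda>h. h \<bullet> d') = (\<lambda>h. h \<bullet> d)"
    using assms unfolding gderiv_def by (rule has_derivative_unique)
  then show "d' = d"
    by (metis inner_commute vector_eq_ldot)
qed (rule assms)

text \<open>In finite dimension the derivative is a linear functional, hence the inner product with
  the vector whose coordinates are its values on the basis. This makes the description operator in
  \<open>grad\<close> well defined wherever \<open>\<phi>\<close> is differentiable.\<close>

lemma GDERIV_grad:
  assumes "\<phi> differentiable (at u)"
  shows "GDERIV \<phi> u :> grad \<phi> u"
proof -
  obtain D where D: "(\<phi> has_derivative D) (at u)"
    using assms unfolding differentiable_def by blast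
  then have lin: "linear D"
    by (rule has_derivative_linear)
  have "D = (\<lambda>h. h \<bullet> (\<Sum>b\<in>Basis. D b *\<^sub>R b))"
  proof
    fix h
    have "D h = D (\<Sum>b\<in>Basis. (h \<bullet> b) *\<^sub>R b)"
      by (simp add: euclidean_representation)
    also have "\<dots> = h \<bullet> (\<Sum>b\<in>Basis. D b *\<^sub>R b)"
      by (simp add: linear_sum[OF lin] linear_scale[OF lin] inner_sum_right mult.commute)
    finally show "D h = h \<bullet> (\<Sum>b\<in>Basis. D b *\<^sub>R b)" .
  qed
  then have "GDERIV \<phi> u :> (\<Sum>b\<in>Basis. D b *\<^sub>R b)"
    using D unfolding gderiv_def by simp
  then show ?thesis
    using grad_eqI by metis
qed

lemma grad_minus:
  assumes "\<phi> differentiable (at u)"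
  shows "grad (\<lambda>u. - \<phi> u) u = - grad \<phi> u"
  by (intro grad_eqI GDERIV_minus GDERIV_grad assms)

lemma grad_eq_0_at_minimum:
  assumes "\<phi> differentiable (at u)" and "\<And>v. \<phi> u \<le> \<phi> v"
  shows "grad \<phi> u = 0"
proof -
  have "(\<lambda>h. h \<bullet> grad \<phi> u) = (\<lambda>h. 0)"
    using GDERIV_grad[OF assms(1)] assms(2) unfolding gderiv_def
    by (intro differential_zero_maxmin[of u UNIV \<phi>]) auto
  \<comment> \<open>The zero functional is evaluated at \<open>grad \<phi> u\<close> itself.\<close>
  then show ?thesis
    by (metis inner_eq_zero_iff)
qed

text \<open>The linear term of the strong convexity inequality vanishes at a minimiser; what remains
  is quadratic growth.\<close>

lemma strongly_convex_at_minimum: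
  assumes "strongly_convex \<nu> \<phi>" and "\<And>v. \<phi> u \<le> \<phi> v"
  shows "\<phi> v - \<phi> u \<ge> \<nu> / 2 * (norm (v - u))\<^sup>2"
proof -
  have "grad \<phi> u = 0"
    using assms unfolding strongly_convex_def by (intro grad_eq_0_at_minimum) auto
  then show ?thesis
    using assms(1) unfolding strongly_convex_def
    by (metis diff_zero inner_zero_left)
qed

subsection \<open>The exact step\<close>

text \<open>The saddle-point operator: the sign turns ascent in the second block into descent, so
  that exact gradient descent ascent is the iteration
  \<open>z - \<alpha> *\<^sub>R Phi f z\<close>.\<close>

definition Phi ::
  "('a::euclidean_space \<times> 'b::euclidean_space \<Rightarrow> real) \<Rightarrow> 'a \<times> 'b \<Rightarrow> 'a \<times> 'b" where
  "Phi f z = (grad_x f z, - grad_y f z)"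

lemma norm_Pair_sq: "(norm (a, b))\<^sup>2 = (norm a)\<^sup>2 + (norm b)\<^sup>2"
  by (simp add: norm_Pair)

text \<open>A saddle point minimises \<open>f\<close> in the first block and \<open>- f\<close> in
  the second, so both partial gradients vanish there.\<close>

lemma Phi_saddle_point:
  assumes "\<And>y. (\<lambda>x. f (x, y)) differentiable (at (fst zs))"
    and "\<And>x. (\<lambda>y. f (x, y)) differentiable (at (snd zs))"
    and "saddle_point f zs"
  shows "Phi f zs = 0"
proof -
  have "grad_x f zs = 0"
    unfolding grad_x_def using assms(1,3)
    by (intro grad_eq_0_at_minimum) (auto simp: saddle_point_def)
  moreover have "grad (\<lambda>y. - f (fst zs, y)) (snd zs) = 0"
    using assms(2,3) by (intro grad_eq_0_at_minimum) (auto simp: saddle_point_def)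
  then have "grad_y f zs = 0"
    unfolding grad_y_def using grad_minus[OF assms(2)] by simp
  ultimately show ?thesis
    by (simp add: Phi_def zero_prod_def)
qed

text \<open>The four inequalities below are strong convexity and concavity at \<open>z\<close> and at the saddle point;
  in their sum all values of \<open>f\<close> cancel.\<close>

lemma inner_Phi_ge:
  assumes "\<And>y. strongly_convex \<mu>\<^sub>x (\<lambda>x. f (x, y))"
    and "\<And>x. strongly_concave \<mu>\<^sub>y (\<lambda>y. f (x, y))"
    and "saddle_point f zs" and "\<mu> \<le> \<mu>\<^sub>x" and "\<mu> \<le> \<mu>\<^sub>y"
  shows "(z - zs) \<bullet> Phi f z \<ge> \<mu> * (norm (z - zs))\<^sup>2"
proof -
  obtain x y where z: "z = (x, y)" by force
  obtain a b where zs: "zs = (a, b)" by force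
  \<comment> \<open>Strong concavity speaks of \<open>- f\<close>; differentiability of
    \<open>f\<close>, required by \<open>grad_minus\<close>, is recovered by negating twice.\<close>
  have diff: "(\<lambda>y. f (x, y)) differentiable (at y)"
    using assms(2)[of x] unfolding strongly_concave_def strongly_convex_def
    by (metis (no_types, lifting) differentiable_minus ext minus_minus)
  have "f (a, y) - f (x, y) - grad_x f z \<bullet> (a - x) \<ge> \<mu>\<^sub>x / 2 * (norm (a - x))\<^sup>2"
    using assms(1)[of y] unfolding strongly_convex_def grad_x_def z by simp
  moreover have "- f (x, b) - (- f (x, y)) - (- grad_y f z) \<bullet> (b - y) \<ge> \<mu>\<^sub>y / 2 * (norm (b - y))\<^sup>2"
    using assms(2)[of x, unfolded strongly_concave_def strongly_convex_def,
        THEN conjunct2, THEN conjunct2, rule_format, of b y] grad_minus[OF diff]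
    by (simp add: grad_y_def z)
  moreover have "f (x, b) - f (a, b) \<ge> \<mu>\<^sub>x / 2 * (norm (x - a))\<^sup>2"
    using assms(3) by (intro strongly_convex_at_minimum assms(1)) (auto simp: saddle_point_def zs)
  moreover have "- f (a, y) - (- f (a, b)) \<ge> \<mu>\<^sub>y / 2 * (norm (y - b))\<^sup>2"
    using assms(3)
    by (intro strongly_convex_at_minimum assms(2)[unfolded strongly_concave_def])
      (auto simp: saddle_point_def zs)
  \<comment> \<open>Each squared distance occurs twice with factor one half: once from the
    inequality based at \<open>z\<close>, once from the one based at the saddle point.\<close>
  ultimately have "(z - zs) \<bullet> Phi f z \<ge> \<mu>\<^sub>x * (norm (x - a))\<^sup>2 + \<mu>\<^sub>y * (norm (y - b))\<^sup>2"
    by (simp add: Phi_def z zs norm_minus_commute inner_commute algebra_simps)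
  moreover have "\<mu>\<^sub>x * (norm (x - a))\<^sup>2 + \<mu>\<^sub>y * (norm (y - b))\<^sup>2
      \<ge> \<mu> * (norm (x - a))\<^sup>2 + \<mu> * (norm (y - b))\<^sup>2"
    using assms(4,5) by (intro add_mono mult_right_mono) auto
  ultimately show ?thesis
    by (simp add: z zs norm_Pair_sq distrib_left)
qed

text \<open>One block is changed at a time, through the intermediate point
  \<open>(fst v, snd u)\<close>.\<close>

lemma norm_diff_le_sum_of_separate:
  fixes g :: "'a::real_normed_vector \<times> 'b::real_normed_vector \<Rightarrow> 'c::real_normed_vector"
  assumes "\<And>x x' y. norm (g (x, y) - g (x', y)) \<le> L * norm (x - x')"
    and "\<And>x y y'. norm (g (x, y) - g (x, y')) \<le> L * norm (y - y')"
  shows "norm (g u - g v) \<le> L * (norm (fst u - fst v) + norm (snd u - snd v))"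
proof -
  have "norm (g u - g v) \<le> norm (g (fst u, snd u) - g (fst v, snd u))
      + norm (g (fst v, snd u) - g (fst v, snd v))"
    using norm_triangle_ineq[of "g u - g (fst v, snd u)" "g (fst v, snd u) - g v"] by simp
  also have "\<dots> \<le> L * norm (fst u - fst v) + L * norm (snd u - snd v)"
    by (intro add_mono assms)
  finally show ?thesis
    by (simp add: distrib_left)
qed

text \<open>Squares \<open>norm_diff_le_sum_of_separate\<close> and uses
  \<open>(a + b)\<^sup>2 \<le> 2 * (a\<^sup>2 + b\<^sup>2)\<close>. Applied to each of the two
  partial gradients, it yields the constant \<open>4 * L\<^sup>2\<close> for
  \<open>Phi\<close>.\<close>

lemma norm_diff_sq_le_of_separate:
  fixes g :: "'a::real_normed_vector \<times> 'b::real_normed_vector \<Rightarrow> 'c::real_normed_vector"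
  assumes "\<And>x x' y. norm (g (x, y) - g (x', y)) \<le> L * norm (x - x')"
    and "\<And>x y y'. norm (g (x, y) - g (x, y')) \<le> L * norm (y - y')"
  shows "(norm (g u - g v))\<^sup>2 \<le> 2 * L\<^sup>2 * (norm (u - v))\<^sup>2"
proof -
  let ?a = "norm (fst u - fst v)" and ?b = "norm (snd u - snd v)"
  have "(norm (g u - g v))\<^sup>2 \<le> (L * (?a + ?b))\<^sup>2"
    by (intro power_mono norm_diff_le_sum_of_separate assms) auto
  also have "\<dots> = L\<^sup>2 * (?a + ?b)\<^sup>2"
    by (simp add: power_mult_distrib)
  also have "\<dots> \<le> L\<^sup>2 * (2 * (?a\<^sup>2 + ?b\<^sup>2))"
    using sum_squares_bound[of ?a ?b] by (intro mult_left_mono) (auto simp: power2_sum)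
  also have "?a\<^sup>2 + ?b\<^sup>2 = (norm (u - v))\<^sup>2"
    by (simp add: norm_prod_def)
  finally show ?thesis
    by simp
qed

text \<open>Serves to make the partial gradients Borel functions of the pair: the Lipschitz bound
  tends to 0 as \<open>u\<close> tends to \<open>v\<close>.\<close>

lemma continuous_of_separate_lipschitz:
  fixes g :: "'a::real_normed_vector \<times> 'b::real_normed_vector \<Rightarrow> 'c::real_normed_vector"
  assumes "\<And>x x' y. norm (g (x, y) - g (x', y)) \<le> L * norm (x - x')"
    and "\<And>x y y'. norm (g (x, y) - g (x, y')) \<le> L * norm (y - y')"
  shows "continuous_on UNIV g"
  unfolding continuous_on_def
proof
  fix v :: "'a \<times> 'b"
  have "((\<lambda>u. L * (norm (fst u - fst v) + norm (snd u - snd v)))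
      \<longlongrightarrow> L * (norm (fst v - fst v) + norm (snd v - snd v))) (at v)"
    by (intro tendsto_intros)
  then have "((\<lambda>u. L * (norm (fst u - fst v) + norm (snd u - snd v))) \<longlongrightarrow> 0) (at v)"
    by simp
  then have "((\<lambda>u. g u - g v) \<longlongrightarrow> 0) (at v)"
    by (rule Lim_null_comparison[rotated])
      (intro always_eventually allI norm_diff_le_sum_of_separate assms)
  then show "(g \<longlongrightarrow> g v) (at v within UNIV)"
    by (rule LIM_zero_cancel)
qed

text \<open>In units of \<open>(norm d)\<^sup>2\<close>, the cross term of the expanded square gains
  \<open>2 * \<alpha> * \<mu>\<close>, and by the stepsize restriction the quadratic term gives back
  at most \<open>\<alpha> * \<mu>\<close>.\<close>

lemma norm_exact_step_sq_le:
  assumes "(d::'a::real_inner) \<bullet> p \<ge> \<mu> * (norm d)\<^sup>2" and "(norm p)\<^sup>2 \<le> 4 * L\<^sup>2 * (norm d)\<^sup>2"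
    and "0 \<le> \<alpha>" and "4 * \<alpha> * L\<^sup>2 \<le> \<mu>"
  shows "(norm (d - \<alpha> *\<^sub>R p))\<^sup>2 \<le> (1 - \<alpha> * \<mu>) * (norm d)\<^sup>2"
proof -
  have "(norm (d - \<alpha> *\<^sub>R p))\<^sup>2 = (norm d)\<^sup>2 - 2 * \<alpha> * (d \<bullet> p) + \<alpha>\<^sup>2 * (norm p)\<^sup>2"
    unfolding power2_norm_eq_inner by (simp add: algebra_simps inner_commute power2_eq_square)
  also have "\<dots> \<le> (norm d)\<^sup>2 - 2 * \<alpha> * (\<mu> * (norm d)\<^sup>2) + \<alpha>\<^sup>2 * (4 * L\<^sup>2 * (norm d)\<^sup>2)"
    using assms by (intro add_mono diff_mono mult_left_mono) auto
  \<comment> \<open>One factor \<open>\<alpha>\<close> is set aside so that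
    \<open>4 * \<alpha> * L\<^sup>2 \<le> \<mu>\<close> can be applied.\<close>
  also have "\<alpha>\<^sup>2 * (4 * L\<^sup>2 * (norm d)\<^sup>2) = (4 * \<alpha> * L\<^sup>2) * (\<alpha> * (norm d)\<^sup>2)"
    by (simp add: power2_eq_square)
  also have "\<dots> \<le> \<mu> * (\<alpha> * (norm d)\<^sup>2)"
    using assms by (intro mult_right_mono) auto
  finally show ?thesis
    by (simp add: algebra_simps)
qed

subsection \<open>Conditionally centred noise\<close>

text \<open>Unlike \<open>real_cond_exp_mult\<close>, this does not assume integrability: it holds for the positive and
  the negative part separately.\<close>

lemma (in sigma_finite_subalgebra) real_cond_exp_indicator:
  assumes A: "A \<in> sets F" and [measurable]: "g \<in> borel_measurable M"
  shows "AE x in M. real_cond_exp M F (\<lambda>x. indicator A x * g x) x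
      = indicator A x * real_cond_exp M F g x"
proof -
  have [measurable]: "(indicator A :: _ \<Rightarrow> ennreal) \<in> borel_measurable F"
    using A by simp
  have *: "AE x in M. nn_cond_exp M F (\<lambda>x. ennreal (indicator A x * h x)) x
      = indicator A x * nn_cond_exp M F (\<lambda>x. ennreal (h x)) x"
    if [measurable]: "h \<in> borel_measurable M" for h
  proof -
    \<comment> \<open>\<open>ennreal\<close> sends negative reals to 0, that is, it takes the
      positive part, and this commutes with multiplication by 0 or 1.\<close>
    have eq: "(\<lambda>x. ennreal (indicator A x * h x)) = (\<lambda>x. indicator A x * ennreal (h x))"
      by (auto simp: indicator_def)
    show ?thesis
      unfolding eq by (rule AE_symmetric[OF nn_cond_exp_prod]) measurable
  qed
  have "AE x in M. nn_cond_exp M F (\<lambda>x. ennreal (- (indicator A x * g x))) x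
      = indicator A x * nn_cond_exp M F (\<lambda>x. ennreal (- g x)) x"
    using *[of "\<lambda>x. - g x"] by simp
  with *[of g] show ?thesis
    by (auto simp: real_cond_exp_def indicator_def)
qed

text \<open>\<open>g\<close> and \<open>h\<close> themselves need not be integrable, so \<open>real_cond_exp_diff\<close> is applied after
  truncation to the events \<open>{|h| \<le> n}\<close>.\<close>

lemma (in finite_measure_subalgebra) real_cond_exp_centred:
  assumes [measurable]: "g \<in> borel_measurable M" and h[measurable]: "h \<in> borel_measurable F"
    and gh: "AE x in M. real_cond_exp M F g x = h x"
    and int: "integrable M (\<lambda>x. g x - h x)"
  shows "AE x in M. real_cond_exp M F (\<lambda>x. g x - h x) x = 0"
proof -
  note [measurable] = measurable_from_subalg[OF subalg h]
  define A where "A n = {x \<in> space F. \<bar>h x\<bar> \<le> real n}" for n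
  have AF[measurable]: "A n \<in> sets F" for n
    unfolding A_def by measurable
  have AM[measurable]: "A n \<in> sets M" for n
    using AF subalg unfolding subalgebra_def by blast
  have trunc: "AE x in M. indicator (A n) x * real_cond_exp M F (\<lambda>x. g x - h x) x = 0" for n
  proof -
    let ?I = "indicator (A n) :: _ \<Rightarrow> real"
    have hI: "integrable M (\<lambda>x. ?I x * h x)"
    proof (rule integrable_const_bound[of _ "real n"])
      show "AE x in M. norm (?I x * h x) \<le> real n"
        by (auto simp: A_def split: split_indicator)
    qed measurable
    have eI: "integrable M (\<lambda>x. ?I x * (g x - h x))"
      using integrable_mult_indicator[OF AM int] by simp
    \<comment> \<open>On \<open>A n\<close>, \<open>g\<close> is the sum of the bounded
      \<open>h\<close> and the integrable difference.\<close>
    have gI: "integrable M (\<lambda>x. ?I x * g x)"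
      using Bochner_Integration.integrable_add[OF hI eI] by (simp add: algebra_simps)
    have "AE x in M. real_cond_exp M F (\<lambda>x. ?I x * g x - ?I x * h x) x
        = real_cond_exp M F (\<lambda>x. ?I x * g x) x - real_cond_exp M F (\<lambda>x. ?I x * h x) x"
      by (rule real_cond_exp_diff[OF gI hI])
    moreover have "AE x in M. real_cond_exp M F (\<lambda>x. ?I x * h x) x = ?I x * h x"
      by (rule real_cond_exp_F_meas[OF hI]) measurable
    moreover have "AE x in M. real_cond_exp M F (\<lambda>x. ?I x * g x - ?I x * h x) x
        = ?I x * real_cond_exp M F (\<lambda>x. g x - h x) x"
      unfolding right_diff_distrib[symmetric] by (rule real_cond_exp_indicator[OF AF]) measurable
    moreover note real_cond_exp_indicator[OF AF[of n] \<open>g \<in> borel_measurable M\<close>] gh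
    ultimately show ?thesis
    proof eventually_elim
      case (elim x)
      show ?case
        unfolding elim(3)[symmetric] elim(1) elim(2) elim(4) elim(5) by simp
    qed
  qed
  \<comment> \<open>The exceptional null set depends on \<open>n\<close>; a countable union of null
    sets is null, and every point lies in some \<open>A n\<close>.\<close>
  then have "AE x in M. \<forall>n. indicator (A n) x * real_cond_exp M F (\<lambda>x. g x - h x) x = 0"
    by (intro AE_all_countable[THEN iffD2] allI)
  with AE_space show ?thesis
  proof eventually_elim
    fix x assume x: "x \<in> space M"
      and "\<forall>n. indicator (A n) x * real_cond_exp M F (\<lambda>x. g x - h x) x = 0"
    moreover obtain n where "\<bar>h x\<bar> \<le> real n"
      using real_arch_simple by blast
    then have "x \<in> A n"
      using x subalg unfolding A_def subalgebra_def by simp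
    ultimately show "real_cond_exp M F (\<lambda>x. g x - h x) x = 0"
      by (metis indicator_simps(1) mult_1)
  qed
qed

text \<open>Cauchy-Schwarz and \<open>a * b \<le> a\<^sup>2 + b\<^sup>2\<close> for nonnegative
  \<open>a\<close> and \<open>b\<close> dominate the inner product by an integrable
  function.\<close>

lemma integrable_inner_of_square_integrable:
  fixes v w :: "'w \<Rightarrow> 'a::euclidean_space"
  assumes [measurable]: "v \<in> borel_measurable M" "w \<in> borel_measurable M"
    and "integrable M (\<lambda>x. (norm (v x))\<^sup>2)" and "integrable M (\<lambda>x. (norm (w x))\<^sup>2)"
  shows "integrable M (\<lambda>x. v x \<bullet> w x)"
proof (rule Bochner_Integration.integrable_bound)
  show "integrable M (\<lambda>x. (norm (v x))\<^sup>2 + (norm (w x))\<^sup>2)"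
    using assms by simp
  show "AE x in M. norm (v x \<bullet> w x) \<le> norm ((norm (v x))\<^sup>2 + (norm (w x))\<^sup>2)"
  proof (rule AE_I2)
    fix x
    have "\<bar>v x \<bullet> w x\<bar> \<le> norm (v x) * norm (w x)"
      by (rule Cauchy_Schwarz_ineq2)
    also have "\<dots> \<le> (norm (v x))\<^sup>2 + (norm (w x))\<^sup>2"
      using sum_squares_bound[of "norm (v x)" "norm (w x)"]
        mult_nonneg_nonneg[OF norm_ge_zero[of "v x"] norm_ge_zero[of "w x"]] by linarith
    finally show "norm (v x \<bullet> w x) \<le> norm ((norm (v x))\<^sup>2 + (norm (w x))\<^sup>2)"
      by simp
  qed
qed measurable

lemma borel_measurable_vec_nth [measurable (raw)]:
  fixes v :: "'w \<Rightarrow> real ^ 'd"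
  assumes "v \<in> borel_measurable N"
  shows "(\<lambda>x. v x $ i) \<in> borel_measurable N"
proof (rule borel_measurable_continuous_on[OF _ assms])
  show "continuous_on UNIV (\<lambda>u :: real ^ 'd. u $ i)"
    by (intro continuous_intros)
qed

text \<open>In each component the \<open>F\<close>-measurable factor \<open>w\<close> moves through
  the conditional expectation of the noise, which is zero. Square integrability of both factors
  makes the products integrable.\<close>

lemma (in finite_measure_subalgebra) integral_inner_centred:
  fixes g h w :: "'a \<Rightarrow> real ^ 'd"
  assumes g[measurable]: "g \<in> borel_measurable M"
    and h[measurable]: "h \<in> borel_measurable F" and w[measurable]: "w \<in> borel_measurable F"
    and gh: "AE x in M. vec_cond_exp M F g x = h x"
    and e2: "integrable M (\<lambda>x. (norm (g x - h x))\<^sup>2)"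
    and w2: "integrable M (\<lambda>x. (norm (w x))\<^sup>2)"
  shows "(\<integral>x. w x \<bullet> (g x - h x) \<partial>M) = 0"
proof -
  note [measurable] = measurable_from_subalg[OF subalg h] measurable_from_subalg[OF subalg w]
  have comp: "integrable M (\<lambda>x. w x $ i * (g x $ i - h x $ i)) \<and>
      (\<integral>x. w x $ i * (g x $ i - h x $ i) \<partial>M) = 0" for i
  proof -
    have bnd: "(norm (v $ i))\<^sup>2 \<le> (norm v)\<^sup>2" for v :: "real ^ 'd"
      using component_le_norm_cart[of v i] by (intro power_mono) auto
    have ei2: "integrable M (\<lambda>x. (norm (g x $ i - h x $ i))\<^sup>2)"
    proof (rule Bochner_Integration.integrable_bound[OF e2])
      show "AE x in M. norm ((norm (g x $ i - h x $ i))\<^sup>2) \<le> norm ((norm (g x - h x))\<^sup>2)"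
        using bnd[of "g x - h x" for x] by simp
    qed measurable
    have wi2: "integrable M (\<lambda>x. (norm (w x $ i))\<^sup>2)"
      by (rule Bochner_Integration.integrable_bound[OF w2]) (use bnd in simp_all)
    \<comment> \<open>The constant 1 is square integrable because the measure is finite, so square
      integrable noise is integrable.\<close>
    have "integrable M (\<lambda>x. 1 \<bullet> (g x $ i - h x $ i))"
      by (rule integrable_inner_of_square_integrable[OF _ _ _ ei2]) auto
    then have "integrable M (\<lambda>x. g x $ i - h x $ i)"
      by simp
    moreover have "AE x in M. real_cond_exp M F (\<lambda>x. g x $ i) x = h x $ i"
      using gh by eventually_elim (auto simp: vec_cond_exp_def vec_eq_iff)
    ultimately have zero: "AE x in M. real_cond_exp M F (\<lambda>x. g x $ i - h x $ i) x = 0"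
      by (intro real_cond_exp_centred) auto
    have prod: "integrable M (\<lambda>x. w x $ i * (g x $ i - h x $ i))"
      using integrable_inner_of_square_integrable[OF _ _ wi2 ei2] by simp
    then have "(\<integral>x. w x $ i * (g x $ i - h x $ i) \<partial>M)
        = (\<integral>x. w x $ i * real_cond_exp M F (\<lambda>x. g x $ i - h x $ i) x \<partial>M)"
      by (intro real_cond_exp_intg(2)[symmetric]) auto
    also have "\<dots> = (\<integral>x. 0 \<partial>M)"
      using zero by (intro integral_cong_AE) auto
    finally show ?thesis
      using prod by simp
  qed
  then show ?thesis
    by (simp add: inner_vec_def Bochner_Integration.integral_sum)
qed

text \<open>Conditioning preserves the total integral: this is \<open>nn_cond_exp_intg\<close> with
  weight 1.\<close>

lemma (in finite_measure_subalgebra) nn_integral_le_of_nn_cond_exp_le: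
  assumes [measurable]: "u \<in> borel_measurable M"
    and "AE x in M. nn_cond_exp M F u x \<le> c"
  shows "(\<integral>\<^sup>+x. u x \<partial>M) \<le> c * emeasure M (space M)"
proof -
  have "(\<integral>\<^sup>+x. u x \<partial>M) = (\<integral>\<^sup>+x. nn_cond_exp M F u x \<partial>M)"
    using nn_cond_exp_intg[of "\<lambda>_. 1" u] by simp
  also have "\<dots> \<le> (\<integral>\<^sup>+x. c \<partial>M)"
    by (rule nn_integral_mono_AE[OF assms(2)])
  finally show ?thesis
    by simp
qed

text \<open>Passes from extended to real integrals, where the expanded square with its signed cross
  term can be integrated term by term.\<close>

lemma integral_le_of_nn_integral_le:
  assumes [measurable]: "u \<in> borel_measurable M" and "\<And>x. 0 \<le> u x" and "0 \<le> c"
    and "(\<integral>\<^sup>+x. ennreal (u x) \<partial>M) \<le> ennreal c"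
  shows "integrable M u" and "(\<integral>x. u x \<partial>M) \<le> c"
proof -
  show int: "integrable M u"
    using assms(2,4) by (intro integrableI_nonneg) (auto intro: le_less_trans)
  show "(\<integral>x. u x \<partial>M) \<le> c"
    using assms nn_integral_eq_integral[OF int] by simp
qed

text \<open>If \<open>w\<close> has infinite second moment, the bound is trivial. Otherwise the
  square is expanded, the cross term integrates to zero, and the variance bound controls the last
  term. The sign of \<open>\<alpha>\<close> is free, which the ascent block uses.\<close>

lemma (in finite_measure_subalgebra) noise_step:
  fixes g h w :: "'a \<Rightarrow> real ^ 'd"
  assumes g[measurable]: "g \<in> borel_measurable M"
    and h[measurable]: "h \<in> borel_measurable F" and w[measurable]: "w \<in> borel_measurable F"
    and gh: "AE x in M. vec_cond_exp M F g x = h x"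
    and var: "AE x in M. nn_cond_exp M F (\<lambda>x. ennreal ((norm (g x - h x))\<^sup>2)) x \<le> ennreal (\<sigma>\<^sup>2)"
    and "prob_space M"
  shows "(\<integral>\<^sup>+x. ennreal ((norm (w x - \<alpha> *\<^sub>R (g x - h x)))\<^sup>2) \<partial>M)
    \<le> (\<integral>\<^sup>+x. ennreal ((norm (w x))\<^sup>2) \<partial>M) + ennreal (\<alpha>\<^sup>2 * \<sigma>\<^sup>2)"
proof (cases "(\<integral>\<^sup>+x. ennreal ((norm (w x))\<^sup>2) \<partial>M) = \<infinity>")
  case False
  note [measurable] = measurable_from_subalg[OF subalg h] measurable_from_subalg[OF subalg w]
  note one = prob_space.emeasure_space_1[OF \<open>prob_space M\<close>]
  let ?e = "\<lambda>x. g x - h x"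
  have w2: "integrable M (\<lambda>x. (norm (w x))\<^sup>2)"
    using False by (intro integrableI_nonneg) (auto simp: less_top)
  have "(\<integral>\<^sup>+x. ennreal ((norm (?e x))\<^sup>2) \<partial>M) \<le> ennreal (\<sigma>\<^sup>2)"
    using nn_integral_le_of_nn_cond_exp_le[OF _ var] one by simp
  then have e2: "integrable M (\<lambda>x. (norm (?e x))\<^sup>2)" and e2_le: "(\<integral>x. (norm (?e x))\<^sup>2 \<partial>M) \<le> \<sigma>\<^sup>2"
    using integral_le_of_nn_integral_le[of "\<lambda>x. (norm (?e x))\<^sup>2" M "\<sigma>\<^sup>2"] by simp_all
  have we: "integrable M (\<lambda>x. w x \<bullet> ?e x)"
    by (rule integrable_inner_of_square_integrable[OF _ _ w2 e2]) auto
  have expand: "(norm (w x - \<alpha> *\<^sub>R ?e x))\<^sup>2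
      = (norm (w x))\<^sup>2 - 2 * \<alpha> * (w x \<bullet> ?e x) + \<alpha>\<^sup>2 * (norm (?e x))\<^sup>2" for x
    unfolding power2_norm_eq_inner by (simp add: algebra_simps inner_commute power2_eq_square)
  have int: "integrable M (\<lambda>x. (norm (w x - \<alpha> *\<^sub>R ?e x))\<^sup>2)"
    unfolding expand using e2 w2 we by simp
  have "(\<integral>x. (norm (w x - \<alpha> *\<^sub>R ?e x))\<^sup>2 \<partial>M)
      = (\<integral>x. (norm (w x))\<^sup>2 \<partial>M) + \<alpha>\<^sup>2 * (\<integral>x. (norm (?e x))\<^sup>2 \<partial>M)"
    unfolding expand using e2 w2 we integral_inner_centred[OF g h w gh e2 w2] by simp
  also have "\<dots> \<le> (\<integral>x. (norm (w x))\<^sup>2 \<partial>M) + \<alpha>\<^sup>2 * \<sigma>\<^sup>2"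
    using e2_le by (intro add_left_mono mult_left_mono) auto
  finally show ?thesis
    using w2 int by (simp add: nn_integral_eq_integral flip: ennreal_plus)
qed simp

subsection \<open>Convergence\<close>

text \<open>\<open>B\<close> is a fixed point of the affine map in the recursion, so the geometric
  term plus \<open>B\<close> is reproduced by each step. Values in \<open>ennreal\<close> allow
  \<open>a 0\<close> to be infinite.\<close>

lemma affine_recursion_bound:
  fixes a :: "nat \<Rightarrow> ennreal" and q B c :: real
  assumes step: "\<And>k. a (Suc k) \<le> ennreal q * a k + ennreal c"
    and "0 \<le> q" and "0 \<le> B" and "0 \<le> c" and fixpoint: "q * B + c = B"
  shows "a k \<le> ennreal (q ^ k) * a 0 + ennreal B"
proof (induction k)
  case (Suc k)
  have "a (Suc k) \<le> ennreal q * (ennreal (q ^ k) * a 0 + ennreal B) + ennreal c"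
    by (rule order_trans[OF step add_right_mono[OF mult_left_mono[OF Suc zero_le]]])
  also have "\<dots> = ennreal (q ^ Suc k) * a 0 + (ennreal (q * B) + ennreal c)"
    using assms(2-4) by (simp add: distrib_left ennreal_mult mult.assoc add.assoc)
  also have "ennreal (q * B) + ennreal c = ennreal B"
    using ennreal_plus[of "q * B" c] assms(2-4) by (simp add: fixpoint del: ennreal_plus)
  finally show ?case .
next
  case 0
  have "a 0 + 0 \<le> a 0 + ennreal B"
    by (intro add_left_mono) auto
  then show ?case
    by simp
qed

theorem theorem3p2:
  fixes M :: "'w measure"
    and f :: "(real ^ 'm) \<times> (real ^ 'n) \<Rightarrow> real"
    and S :: "'s measure" and T :: "'t measure"
    and gx :: "(real ^ 'm) \<times> (real ^ 'n) \<Rightarrow> 's \<Rightarrow> real ^ 'm"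
    and gy :: "(real ^ 'm) \<times> (real ^ 'n) \<Rightarrow> 't \<Rightarrow> real ^ 'n"
    and \<zeta> :: "nat \<Rightarrow> 'w \<Rightarrow> 's" and \<xi> :: "nat \<Rightarrow> 'w \<Rightarrow> 't"
    and z :: "nat \<Rightarrow> 'w \<Rightarrow> (real ^ 'm) \<times> (real ^ 'n)"
    and zs :: "(real ^ 'm) \<times> (real ^ 'n)"
    and \<alpha> \<mu> L \<mu>\<^sub>x \<mu>\<^sub>y L\<^sub>x L\<^sub>y L\<^sub>x\<^sub>y L\<^sub>y\<^sub>x \<sigma> :: real
  assumes "prob_space M"
    and "continuously_differentiable f"
    and "\<mu>\<^sub>x > 0" and "\<mu>\<^sub>y > 0"
    and "\<And>y. smooth_fun L\<^sub>x (\<lambda>x. f (x, y))"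
    and "\<And>y. strongly_convex \<mu>\<^sub>x (\<lambda>x. f (x, y))"
    and "\<And>x. smooth_fun L\<^sub>y (\<lambda>y. f (x, y))"
    and "\<And>x. strongly_concave \<mu>\<^sub>y (\<lambda>y. f (x, y))"
    and "\<And>x y y'. norm (grad_x f (x, y) - grad_x f (x, y')) \<le> L\<^sub>x\<^sub>y * norm (y - y')"
    and "\<And>x x' y. norm (grad_y f (x, y) - grad_y f (x', y)) \<le> L\<^sub>y\<^sub>x * norm (x - x')"
    and "\<mu> = min \<mu>\<^sub>x \<mu>\<^sub>y"
    and "L = Max {L\<^sub>x, L\<^sub>y, L\<^sub>x\<^sub>y, L\<^sub>y\<^sub>x}"
    and "saddle_point f zs"
    and "z 0 \<in> borel_measurable M"
    and "stochastic_oracle M f \<sigma> S T gx gy \<zeta> \<xi> z"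
    and "0 < \<alpha>" and "\<alpha> \<le> \<mu> / (4 * L\<^sup>2)"
    and "\<And>k \<omega>. \<omega> \<in> space M \<Longrightarrow>
           z (Suc k) \<omega> = z k \<omega> - \<alpha> *\<^sub>R stoch_Phi gx gy (\<zeta> k \<omega>) (\<xi> k \<omega>) (z k \<omega>)"
  shows "(\<forall>k\<ge>1. mean_sq_dist M (z k) zs
            \<le> ennreal (1 - \<alpha> * \<mu>) * mean_sq_dist M (z (k - 1)) zs + ennreal (2 * \<alpha>\<^sup>2 * \<sigma>\<^sup>2)) \<and>
         (\<forall>k. mean_sq_dist M (z k) zs
            \<le> ennreal ((1 - \<alpha> * \<mu>) ^ k) * mean_sq_dist M (z 0) zs + ennreal (2 * \<alpha> * \<sigma>\<^sup>2 / \<mu>))"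
proof -
  interpret prob_space M by fact
  obtain xs ys where zs: "zs = (xs, ys)" by force
  have diff_x: "(\<lambda>x. f (x, y)) differentiable (at x)" for x y
    using assms(5) unfolding smooth_fun_def by blast
  have diff_y: "(\<lambda>y. f (x, y)) differentiable (at y)" for x y
    using assms(7) unfolding smooth_fun_def by blast
  have L_ge: "L\<^sub>x \<le> L" "L\<^sub>y \<le> L" "L\<^sub>x\<^sub>y \<le> L" "L\<^sub>y\<^sub>x \<le> L"
    unfolding assms(12) by (auto intro: Max_ge)
  have \<mu>: "0 < \<mu>" "\<mu> \<le> \<mu>\<^sub>x" "\<mu> \<le> \<mu>\<^sub>y"
    using assms(3,4) unfolding assms(11) by auto
  \<comment> \<open>Division by zero yields 0, so \<open>L = 0\<close> would force
    \<open>\<alpha> \<le> 0\<close>.\<close>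
  have "L \<noteq> 0"
    using assms(16,17) by auto
  then have \<alpha>L: "4 * \<alpha> * L\<^sup>2 \<le> \<mu>"
    using assms(17) by (simp add: field_simps)

  \<comment> \<open>Lipschitz bounds with the common constant and measurability of the partial
    gradients\<close>
  have gx_x: "norm (grad_x f (x, y) - grad_x f (x', y)) \<le> L * norm (x - x')" for x x' y
  proof -
    have "norm (grad_x f (x, y) - grad_x f (x', y)) \<le> L\<^sub>x * norm (x - x')"
      using assms(5)[of y] unfolding smooth_fun_def grad_x_def by simp
    then show ?thesis
      using mult_right_mono[OF L_ge(1) norm_ge_zero] by (rule order_trans)
  qed
  have gy_y: "norm (grad_y f (x, y) - grad_y f (x, y')) \<le> L * norm (y - y')" for x y y'
  proof -
    have "norm (grad_y f (x, y) - grad_y f (x, y')) \<le> L\<^sub>y * norm (y - y')"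
      using assms(7)[of x] unfolding smooth_fun_def grad_y_def by simp
    then show ?thesis
      using mult_right_mono[OF L_ge(2) norm_ge_zero] by (rule order_trans)
  qed
  have gx_y: "norm (grad_x f (x, y) - grad_x f (x, y')) \<le> L * norm (y - y')" for x y y'
    using assms(9) mult_right_mono[OF L_ge(3) norm_ge_zero] by (rule order_trans)
  have gy_x: "norm (grad_y f (x, y) - grad_y f (x', y)) \<le> L * norm (x - x')" for x x' y
    using assms(10) mult_right_mono[OF L_ge(4) norm_ge_zero] by (rule order_trans)
  have [measurable]: "grad_x f \<in> borel_measurable borel" "grad_y f \<in> borel_measurable borel"
    using continuous_of_separate_lipschitz[of "grad_x f" L, OF gx_x gx_y]
      continuous_of_separate_lipschitz[of "grad_y f" L, OF gy_x gy_y]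
    by (auto intro: borel_measurable_continuous_onI)

  \<comment> \<open>Contraction of the exact step\<close>
  have contraction: "(norm (v - zs - \<alpha> *\<^sub>R Phi f v))\<^sup>2 \<le> (1 - \<alpha> * \<mu>) * (norm (v - zs))\<^sup>2" for v
  proof (rule norm_exact_step_sq_le[OF _ _ less_imp_le[OF \<open>0 < \<alpha>\<close>] \<alpha>L])
    show "(v - zs) \<bullet> Phi f v \<ge> \<mu> * (norm (v - zs))\<^sup>2"
      by (rule inner_Phi_ge[OF assms(6,8,13) \<mu>(2,3)])
    have "Phi f zs = 0"
      by (rule Phi_saddle_point[OF diff_x diff_y assms(13)])
    then have "(norm (Phi f v))\<^sup>2 = (norm (grad_x f v - grad_x f zs))\<^sup>2 + (norm (grad_y f v - grad_y f zs))\<^sup>2"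
      by (simp add: Phi_def zero_prod_def norm_Pair_sq)
    also have "\<dots> \<le> 2 * L\<^sup>2 * (norm (v - zs))\<^sup>2 + 2 * L\<^sup>2 * (norm (v - zs))\<^sup>2"
      by (intro add_mono norm_diff_sq_le_of_separate gx_x gx_y gy_x gy_y)
    finally show "(norm (Phi f v))\<^sup>2 \<le> 4 * L\<^sup>2 * (norm (v - zs))\<^sup>2"
      by simp
  qed
  \<comment> \<open>The contraction at any point other than \<open>zs\<close> forces a nonnegative
    factor; \<open>zs + (1, 0)\<close> is such a point, as \<open>1\<close> is the all-ones vector.
    The sign keeps \<open>ennreal\<close> from truncating the factor to 0.\<close>
  have q: "0 \<le> 1 - \<alpha> * \<mu>"
  proof -
    have "0 \<le> (1 - \<alpha> * \<mu>) * (norm (zs + (1, 0) - zs))\<^sup>2"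
      by (rule order_trans[OF zero_le_power2 contraction])
    moreover have "0 < (norm (zs + (1, 0) - zs))\<^sup>2"
      by (simp add: norm_Pair)
    ultimately show ?thesis
      by (simp add: zero_le_mult_iff)
  qed

  \<comment> \<open>Measurability of the estimates and of the iterates\<close>
  note estimates = assms(15)[unfolded stochastic_oracle_def]
  have [measurable]: "(\<lambda>(u, s). gx u s) \<in> borel_measurable (borel \<Otimes>\<^sub>M S)"
    "(\<lambda>(u, t). gy u t) \<in> borel_measurable (borel \<Otimes>\<^sub>M T)"
    "\<zeta> k \<in> measurable M S" "\<xi> k \<in> measurable M T" for k
    using estimates by auto
  have gx_meas: "(\<lambda>\<omega>. gx (v \<omega>) (\<zeta> k \<omega>)) \<in> borel_measurable M"
    and gy_meas: "(\<lambda>\<omega>. gy (v \<omega>) (\<xi> k \<omega>)) \<in> borel_measurable M"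
    if [measurable]: "v \<in> borel_measurable M" for v k
  proof -
    have "(\<lambda>\<omega>. (\<lambda>(u, s). gx u s) (v \<omega>, \<zeta> k \<omega>)) \<in> borel_measurable M"
      by measurable
    then show "(\<lambda>\<omega>. gx (v \<omega>) (\<zeta> k \<omega>)) \<in> borel_measurable M" by simp
    have "(\<lambda>\<omega>. (\<lambda>(u, t). gy u t) (v \<omega>, \<xi> k \<omega>)) \<in> borel_measurable M"
      by measurable
    then show "(\<lambda>\<omega>. gy (v \<omega>) (\<xi> k \<omega>)) \<in> borel_measurable M" by simp
  qed
  have z_meas[measurable]: "z k \<in> borel_measurable M" for k
  proof (induction k)
    case (Suc k)
    note [measurable] = Suc gx_meas[OF Suc, of k] gy_meas[OF Suc, of k]
    have "(\<lambda>\<omega>. z k \<omega> - \<alpha> *\<^sub>R stoch_Phi gx gy (\<zeta> k \<omega>) (\<xi> k \<omega>) (z k \<omega>)) \<in> borel_measurable M"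
      unfolding stoch_Phi_def by (intro borel_measurable_diff borel_measurable_scaleR borel_measurable_Pair) auto
    \<comment> \<open>The update rule is given only on \<open>space M\<close>, so measurability is
      transferred by congruence there.\<close>
    moreover have "z (Suc k) \<in> borel_measurable M \<longleftrightarrow>
        (\<lambda>\<omega>. z k \<omega> - \<alpha> *\<^sub>R stoch_Phi gx gy (\<zeta> k \<omega>) (\<xi> k \<omega>) (z k \<omega>)) \<in> borel_measurable M"
      by (intro measurable_cong assms(18))
    ultimately show ?case
      by blast
  qed (rule assms(14))

  \<comment> \<open>The one-step recursion\<close>
  have step: "mean_sq_dist M (z (Suc k)) zs
      \<le> ennreal (1 - \<alpha> * \<mu>) * mean_sq_dist M (z k) zs + ennreal (2 * \<alpha>\<^sup>2 * \<sigma>\<^sup>2)" for k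
  proof -
    define F where "F = generated_by M borel (z k)"
    have "subalgebra M F"
      unfolding subalgebra_def F_def generated_by_def
      using measurable_sets[OF z_meas, of _ k] by (auto simp: sets_vimage_algebra2)
    then interpret finite_measure_subalgebra M F
      by unfold_locales
    have zF[measurable]: "z k \<in> borel_measurable F"
      unfolding F_def generated_by_def by (rule measurable_vimage_algebra1) simp
    note [measurable] = gx_meas[OF z_meas, of k k] gy_meas[OF z_meas, of k k]
    have centred: "AE \<omega> in M. vec_cond_exp M F (\<lambda>\<omega>. gx (z k \<omega>) (\<zeta> k \<omega>)) \<omega> = grad_x f (z k \<omega>)"
      "AE \<omega> in M. vec_cond_exp M F (\<lambda>\<omega>. gy (z k \<omega>) (\<xi> k \<omega>)) \<omega> = grad_y f (z k \<omega>)"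
      unfolding F_def using estimates by simp_all
    have variance: "AE \<omega> in M. nn_cond_exp M F
          (\<lambda>\<omega>. ennreal ((norm (gx (z k \<omega>) (\<zeta> k \<omega>) - grad_x f (z k \<omega>)))\<^sup>2)) \<omega> \<le> ennreal (\<sigma>\<^sup>2)"
      "AE \<omega> in M. nn_cond_exp M F
          (\<lambda>\<omega>. ennreal ((norm (gy (z k \<omega>) (\<xi> k \<omega>) - grad_y f (z k \<omega>)))\<^sup>2)) \<omega> \<le> ennreal (\<sigma>\<^sup>2)"
      unfolding F_def using estimates by simp_all
    \<comment> \<open>\<open>wx\<close> and \<open>wy\<close> are the blocks of the exact step
      relative to \<open>zs\<close>, hence functions of \<open>z k\<close> alone; \<open>x'\<close>
      and \<open>y'\<close> add the noise. The ascent block is written with stepsize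
      \<open>- \<alpha>\<close> so that \<open>noise_step\<close> covers it too.\<close>
    define wx where "wx \<omega> = fst (z k \<omega>) - xs - \<alpha> *\<^sub>R grad_x f (z k \<omega>)" for \<omega>
    define wy where "wy \<omega> = snd (z k \<omega>) - ys - (- \<alpha>) *\<^sub>R grad_y f (z k \<omega>)" for \<omega>
    define x' where "x' \<omega> = wx \<omega> - \<alpha> *\<^sub>R (gx (z k \<omega>) (\<zeta> k \<omega>) - grad_x f (z k \<omega>))" for \<omega>
    define y' where "y' \<omega> = wy \<omega> - (- \<alpha>) *\<^sub>R (gy (z k \<omega>) (\<xi> k \<omega>) - grad_y f (z k \<omega>))" for \<omega>
    have [measurable]: "(\<lambda>\<omega>. fst (z k \<omega>)) \<in> borel_measurable F" "(\<lambda>\<omega>. snd (z k \<omega>)) \<in> borel_measurable F"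
      by (rule measurable_compose[OF zF], intro borel_measurable_continuous_onI continuous_intros)+
    have w_F[measurable]: "wx \<in> borel_measurable F" "wy \<in> borel_measurable F"
      unfolding wx_def wy_def by measurable
    note [measurable] = measurable_from_subalg[OF subalg w_F(1)] measurable_from_subalg[OF subalg w_F(2)]
    have [measurable]: "x' \<in> borel_measurable M" "y' \<in> borel_measurable M"
      unfolding x'_def y'_def by measurable
    have step_x: "(\<integral>\<^sup>+\<omega>. ennreal ((norm (x' \<omega>))\<^sup>2) \<partial>M)
        \<le> (\<integral>\<^sup>+\<omega>. ennreal ((norm (wx \<omega>))\<^sup>2) \<partial>M) + ennreal (\<alpha>\<^sup>2 * \<sigma>\<^sup>2)"
      unfolding x'_def
      by (rule noise_step[OF _ _ w_F(1) centred(1) variance(1) \<open>prob_space M\<close>]) measurable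
    have "(\<integral>\<^sup>+\<omega>. ennreal ((norm (y' \<omega>))\<^sup>2) \<partial>M)
        \<le> (\<integral>\<^sup>+\<omega>. ennreal ((norm (wy \<omega>))\<^sup>2) \<partial>M) + ennreal ((- \<alpha>)\<^sup>2 * \<sigma>\<^sup>2)"
      unfolding y'_def
      by (rule noise_step[OF _ _ w_F(2) centred(2) variance(2) \<open>prob_space M\<close>]) measurable
    then have step_y: "(\<integral>\<^sup>+\<omega>. ennreal ((norm (y' \<omega>))\<^sup>2) \<partial>M)
        \<le> (\<integral>\<^sup>+\<omega>. ennreal ((norm (wy \<omega>))\<^sup>2) \<partial>M) + ennreal (\<alpha>\<^sup>2 * \<sigma>\<^sup>2)"
      by simp
    \<comment> \<open>The exact gradient cancels between the exact step and the noise, which leaves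
      the stochastic update.\<close>
    have next_iterate: "z (Suc k) \<omega> - zs = (x' \<omega>, y' \<omega>)" if "\<omega> \<in> space M" for \<omega>
      unfolding assms(18)[OF that] stoch_Phi_def x'_def y'_def wx_def wy_def zs
      by (simp add: prod_eq_iff algebra_simps)
    have exact: "z k \<omega> - zs - \<alpha> *\<^sub>R Phi f (z k \<omega>) = (wx \<omega>, wy \<omega>)" for \<omega>
      unfolding Phi_def wx_def wy_def zs by (simp add: prod_eq_iff)
    have "mean_sq_dist M (z (Suc k)) zs = (\<integral>\<^sup>+\<omega>. ennreal ((norm (x' \<omega>))\<^sup>2) + ennreal ((norm (y' \<omega>))\<^sup>2) \<partial>M)"
      unfolding mean_sq_dist_def
      by (intro nn_integral_cong) (simp add: next_iterate norm_Pair_sq)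
    also have "\<dots> = (\<integral>\<^sup>+\<omega>. ennreal ((norm (x' \<omega>))\<^sup>2) \<partial>M) + (\<integral>\<^sup>+\<omega>. ennreal ((norm (y' \<omega>))\<^sup>2) \<partial>M)"
      by (rule nn_integral_add) measurable
    \<comment> \<open>Each of the two blocks contributes
      \<open>\<alpha>\<^sup>2 * \<sigma>\<^sup>2\<close>, hence the factor 2 in the noise
      term.\<close>
    also have "\<dots> \<le> ((\<integral>\<^sup>+\<omega>. ennreal ((norm (wx \<omega>))\<^sup>2) \<partial>M) + ennreal (\<alpha>\<^sup>2 * \<sigma>\<^sup>2))
        + ((\<integral>\<^sup>+\<omega>. ennreal ((norm (wy \<omega>))\<^sup>2) \<partial>M) + ennreal (\<alpha>\<^sup>2 * \<sigma>\<^sup>2))"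
      by (rule add_mono[OF step_x step_y])
    also have "\<dots> = ((\<integral>\<^sup>+\<omega>. ennreal ((norm (wx \<omega>))\<^sup>2) \<partial>M) + (\<integral>\<^sup>+\<omega>. ennreal ((norm (wy \<omega>))\<^sup>2) \<partial>M))
        + (ennreal (\<alpha>\<^sup>2 * \<sigma>\<^sup>2) + ennreal (\<alpha>\<^sup>2 * \<sigma>\<^sup>2))"
      by (simp only: ac_simps)
    also have "(\<integral>\<^sup>+\<omega>. ennreal ((norm (wx \<omega>))\<^sup>2) \<partial>M) + (\<integral>\<^sup>+\<omega>. ennreal ((norm (wy \<omega>))\<^sup>2) \<partial>M)
        = (\<integral>\<^sup>+\<omega>. ennreal ((norm (wx \<omega>))\<^sup>2) + ennreal ((norm (wy \<omega>))\<^sup>2) \<partial>M)"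
      by (rule nn_integral_add[symmetric]) measurable
    also have "\<dots> = (\<integral>\<^sup>+\<omega>. ennreal ((norm (z k \<omega> - zs - \<alpha> *\<^sub>R Phi f (z k \<omega>)))\<^sup>2) \<partial>M)"
      by (simp add: exact norm_Pair_sq)
    also have "\<dots> \<le> (\<integral>\<^sup>+\<omega>. ennreal (1 - \<alpha> * \<mu>) * ennreal ((norm (z k \<omega> - zs))\<^sup>2) \<partial>M)"
      using contraction q by (intro nn_integral_mono) (simp flip: ennreal_mult)
    also have "\<dots> = ennreal (1 - \<alpha> * \<mu>) * mean_sq_dist M (z k) zs"
      unfolding mean_sq_dist_def by (rule nn_integral_cmult) measurable
    also have "ennreal (\<alpha>\<^sup>2 * \<sigma>\<^sup>2) + ennreal (\<alpha>\<^sup>2 * \<sigma>\<^sup>2) = ennreal (2 * \<alpha>\<^sup>2 * \<sigma>\<^sup>2)"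
      by (simp flip: ennreal_plus)
    finally show ?thesis
      by (simp add: add_right_mono)
  qed

  \<comment> \<open>Unrolling the recursion\<close>
  have "mean_sq_dist M (z k) zs
      \<le> ennreal ((1 - \<alpha> * \<mu>) ^ k) * mean_sq_dist M (z 0) zs + ennreal (2 * \<alpha> * \<sigma>\<^sup>2 / \<mu>)" for k
  proof (rule affine_recursion_bound[where a = "\<lambda>k. mean_sq_dist M (z k) zs", OF step q])
    \<comment> \<open>In one step the fixed point loses the fraction \<open>\<alpha> * \<mu>\<close>
      of itself, which is exactly the noise term
      \<open>2 * \<alpha>\<^sup>2 * \<sigma>\<^sup>2\<close>.\<close>
    show "(1 - \<alpha> * \<mu>) * (2 * \<alpha> * \<sigma>\<^sup>2 / \<mu>) + 2 * \<alpha>\<^sup>2 * \<sigma>\<^sup>2 = 2 * \<alpha> * \<sigma>\<^sup>2 / \<mu>"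
      using \<open>0 < \<mu>\<close> by (simp add: field_simps power2_eq_square)
  qed (use \<open>0 < \<alpha>\<close> \<open>0 < \<mu>\<close> in auto)
  \<comment> \<open>Subtraction of naturals truncates; \<open>1 \<le> k\<close> ensures
    \<open>Suc (k - 1) = k\<close>.\<close>
  moreover have "mean_sq_dist M (z k) zs
      \<le> ennreal (1 - \<alpha> * \<mu>) * mean_sq_dist M (z (k - 1)) zs + ennreal (2 * \<alpha>\<^sup>2 * \<sigma>\<^sup>2)"
    if "1 \<le> k" for k
    using step[of "k - 1"] that by simp
  ultimately show ?thesis
    by blast
qed

end
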